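(* Let $x=(\nu_1,\dots,\nu_8;\kappa_1,\kappa_2;f,g)$ and let $x'=(\nu'_1,\dots,\nu'_8;\kappa'_1,\kappa'_2;f',g')\in K^{12}$ be a tuple with $x'\sim x$, where $\sim$ is the equivalence of type $D_5^{(1)}$ given in the context. Then for each generator $w\in\{s_0,s_1,s_2,s_3,s_4,s_5,\pi_1,\pi_2\}$ of $\widetilde W(D_5^{(1)})$, the action of $w$ on $x'$ has the same form as its action on $x$ up to the equivalence; that is, writing $w(x)=R_w(x)$ with $R_w$ the explicit tuple of rational expressions defining $w$, $$\bigl(w(\nu'_1),\dots,w(\nu'_8);w(\kappa'_1),w(\kappa'_2);w(f'),w(g')\bigr)\sim R_w(\nu'_1,\dots,\nu'_8;\kappa'_1,\kappa'_2;f',g').$$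
   Context: Let $K=\mathbb{C}(\nu_1,\dots,\nu_8,\kappa_1,\kappa_2,f,g)$ be the field of rational functions in 12 independent variables, and put $q=\kappa_1^2\kappa_2^2/(\nu_1\nu_2\cdots\nu_8)\in K$ (i.e. $\kappa_1^2\kappa_2^2=q\,\nu_1\cdots\nu_8$). Action of the generators of the extended affine Weyl group $\widetilde W(D_5^{(1)})$: the following are $\mathbb{C}$-algebra automorphisms of $K$; variables not mentioned are fixed. - $s_0:\nu_7\leftrightarrow\nu_8$; $s_1:\nu_3\leftrightarrow\nu_4$; $s_4:\nu_1\leftrightarrow\nu_2$; $s_5:\nu_5\leftrightarrow\nu_6$. - $s_2:\ \nu_3\to\frac{\kappa_1}{\nu_7},\ \nu_7\to\frac{\kappa_1}{\nu_3},\ \kappa_2\to\frac{\kappa_1\kappa_2}{\nu_3\nu_7},\ g\to g\,\frac{f-\nu_3}{f-\kappa_1/\nu_7}$. - $s_3:\ \nu_1\to\frac{\kappa_2}{\nu_5},\ \nu_5\to\frac{\kappa_2}{\nu_1},\ \kappa_1\to\frac{\kappa_1\kappa_2}{\nu_1\nu_5},\ f\to f\,\frac{g-1/\nu_1}{g-\nu_5/\kappa_2}$. - $\pi_1:\ \nu_1\to1/\nu_1,\ \nu_2\to1/\nu_2,\ \nu_3\to1/\nu_7,\ \nu_4\to1/\nu_8,\ \nu_5\to1/\nu_5,\ \nu_6\to1/\nu_6,\ \nu_7\to1/\nu_3,\ \nu_8\to1/\nu_4,\ \kappa_1\to1/\kappa_1,\ \kappa_2\to1/\kappa_2,\ f\to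 f/\kappa_1,\ g\to1/g$ (and $q\to1/q$). - $\pi_2:\ \nu_1\to1/\nu_7,\ \nu_2\to1/\nu_8,\ \nu_3\to1/\nu_5,\ \nu_4\to1/\nu_6,\ \nu_5\to1/\nu_3,\ \nu_6\to1/\nu_4,\ \nu_7\to1/\nu_1,\ \nu_8\to1/\nu_2,\ \kappa_1\to1/\kappa_2,\ \kappa_2\to1/\kappa_1,\ f\to1/(\kappa_2 g),\ g\to\kappa_1/f$ (and $q\to1/q$). For each generator $w$, $R_w$ denotes the 12-tuple of rational expressions listed above giving $(w(\nu_1),\dots,w(\nu_8);w(\kappa_1),w(\kappa_2);w(f),w(g))$ in terms of $x$; $R_w(x')$ is obtained by substituting the entries of $x'$ for the corresponding variables. Equivalence of type $D_5^{(1)}$: two tuples $y'$ and $y=(\nu_1,\dots,\nu_8;\kappa_1,\kappa_2;f,g)$ with entries in $K$ satisfy $y'\sim y$ iff there exist $a,b,c,d\in K\setminus\{0\}$ such that $$y'=(a\nu_1,a\nu_2,b\nu_3,b\nu_4,c\nu_5,c\nu_6,d\nu_7,d\nu_8;\ bd\,\kappa_1,\ ac\,\kappa_2;\ bf,\ g/a)$$ (here $\nu_i,\kappa_i,f,g$ denote the entries of $y$, whatever elements of $K$ they are). *)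

theory Defs
  imports
    Complex_Main
    "HOL-Library.Poly_Mapping"
    "HOL-Computational_Algebra.Fraction_Field"
begin

section \<open>The field of rational functions in the twelve variables\<close>

datatype var =
    Nu1 | Nu2 | Nu3 | Nu4 | Nu5 | Nu6 | Nu7 | Nu8 | Kappa1 | Kappa2 | F | G

lemma UNIV_var:
  "(UNIV :: var set) = {Nu1, Nu2, Nu3, Nu4, Nu5, Nu6, Nu7, Nu8, Kappa1, Kappa2, F, G}"
  using var.exhaust by blast

instance var :: finite
  by standard (simp add: UNIV_var)

text \<open>
  The linear order on the variables has no mathematical role: it is only needed because the library
  proves that the polynomial ring below is an integral domain by means of a monomial order.
\<close>

fun var_index :: "var \<Rightarrow> nat" where
  "var_index Nu1 = 1" | "var_index Nu2 = 2" | "var_index Nu3 = 3" | "var_index Nu4 = 4"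
| "var_index Nu5 = 5" | "var_index Nu6 = 6" | "var_index Nu7 = 7" | "var_index Nu8 = 8"
| "var_index Kappa1 = 9" | "var_index Kappa2 = 10" | "var_index F = 11" | "var_index G = 12"

lemma var_index_inject: "var_index u = var_index v \<longleftrightarrow> u = v"
  by (cases u; cases v) simp_all

instantiation var :: linorder
begin

definition less_eq_var :: "var \<Rightarrow> var \<Rightarrow> bool"
  where "less_eq_var u v \<longleftrightarrow> var_index u \<le> var_index v"

definition less_var :: "var \<Rightarrow> var \<Rightarrow> bool"
  where "less_var u v \<longleftrightarrow> var_index u < var_index v"

instance
  by standard (auto simp: less_eq_var_def less_var_def var_index_inject)

end

text \<open>
  A monomial is a finitely supported exponent function, a polynomial a finitely supported
  coefficient function on the monomials (the product is the convolution product of the library).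
\<close>

type_synonym polyn = "(var \<Rightarrow>\<^sub>0 nat) \<Rightarrow>\<^sub>0 complex"
type_synonym ratfun = "polyn fract"

definition const :: "complex \<Rightarrow> ratfun"
  where "const c = Fract (Poly_Mapping.single 0 c) 1"

definition X :: "var \<Rightarrow> ratfun"
  where "X v = Fract (Poly_Mapping.single (Poly_Mapping.single v 1) 1) 1"

definition algebra_automorphism :: "(ratfun \<Rightarrow> ratfun) \<Rightarrow> bool"
  where "algebra_automorphism \<phi> \<longleftrightarrow>
    bij \<phi> \<and>
    (\<forall>r s. \<phi> (r + s) = \<phi> r + \<phi> s) \<and>
    (\<forall>r s. \<phi> (r * s) = \<phi> r * \<phi> s) \<and>
    (\<forall>c. \<phi> (const c) = const c)"


section \<open>The generators\<close>

text \<open>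
  A tuple $(\nu_1,\dots,\nu_8;\kappa_1,\kappa_2;f,g)$ with entries in a field is the function
  assigning to each variable the entry in its position. In particular \<^const>\<open>X\<close> itself is the
  tuple of the variables.
\<close>

type_synonym 'a tuple = "var \<Rightarrow> 'a"

datatype generator = S0 | S1 | S2 | S3 | S4 | S5 | Pi1 | Pi2

text \<open>
  The expressions on the right-hand sides are evaluated at the original tuple \<open>y\<close>, so the updates
  are simultaneous substitutions. Division is the total division of the library; on a tuple
  equivalent to \<^const>\<open>X\<close> none of the denominators vanishes.
\<close>

fun R :: "generator \<Rightarrow> 'a::field tuple \<Rightarrow> 'a tuple" where
  "R S0 y = y(Nu7 := y Nu8, Nu8 := y Nu7)"
| "R S1 y = y(Nu3 := y Nu4, Nu4 := y Nu3)"
| "R S2 y = y(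
     Nu3 := y Kappa1 / y Nu7,
     Nu7 := y Kappa1 / y Nu3,
     Kappa2 := y Kappa1 * y Kappa2 / (y Nu3 * y Nu7),
     G := y G * ((y F - y Nu3) / (y F - y Kappa1 / y Nu7)))"
| "R S3 y = y(
     Nu1 := y Kappa2 / y Nu5,
     Nu5 := y Kappa2 / y Nu1,
     Kappa1 := y Kappa1 * y Kappa2 / (y Nu1 * y Nu5),
     F := y F * ((y G - 1 / y Nu1) / (y G - y Nu5 / y Kappa2)))"
| "R S4 y = y(Nu1 := y Nu2, Nu2 := y Nu1)"
| "R S5 y = y(Nu5 := y Nu6, Nu6 := y Nu5)"
| "R Pi1 y = y(
     Nu1 := 1 / y Nu1, Nu2 := 1 / y Nu2,
     Nu3 := 1 / y Nu7, Nu4 := 1 / y Nu8,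
     Nu5 := 1 / y Nu5, Nu6 := 1 / y Nu6,
     Nu7 := 1 / y Nu3, Nu8 := 1 / y Nu4,
     Kappa1 := 1 / y Kappa1, Kappa2 := 1 / y Kappa2,
     F := y F / y Kappa1, G := 1 / y G)"
| "R Pi2 y = y(
     Nu1 := 1 / y Nu7, Nu2 := 1 / y Nu8,
     Nu3 := 1 / y Nu5, Nu4 := 1 / y Nu6,
     Nu5 := 1 / y Nu3, Nu6 := 1 / y Nu4,
     Nu7 := 1 / y Nu1, Nu8 := 1 / y Nu2,
     Kappa1 := 1 / y Kappa2, Kappa2 := 1 / y Kappa1,
     F := 1 / (y Kappa2 * y G), G := y Kappa1 / y F)"

text \<open>
  The action of a generator is the unique $\mathbb{C}$-algebra automorphism sending the variables
  to the prescribed expressions; see \<open>action_ex1\<close> below for existence and uniqueness.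
\<close>

definition action :: "generator \<Rightarrow> ratfun \<Rightarrow> ratfun"
  where "action w = (THE \<phi>. algebra_automorphism \<phi> \<and> (\<forall>v. \<phi> (X v) = R w X v))"


section \<open>Equivalence of type $D_5^{(1)}$\<close>

definition rescale :: "'a::field \<Rightarrow> 'a \<Rightarrow> 'a \<Rightarrow> 'a \<Rightarrow> 'a tuple \<Rightarrow> 'a tuple"
  where "rescale a b c d y = y(
     Nu1 := a * y Nu1, Nu2 := a * y Nu2,
     Nu3 := b * y Nu3, Nu4 := b * y Nu4,
     Nu5 := c * y Nu5, Nu6 := c * y Nu6,
     Nu7 := d * y Nu7, Nu8 := d * y Nu8,
     Kappa1 := b * d * y Kappa1, Kappa2 := a * c * y Kappa2,
     F := b * y F, G := y G / a)"

definition equivD5 :: "'a::field tuple \<Rightarrow> 'a tuple \<Rightarrow> bool" (infix \<open>\<sim>\<^sub>D\<close> 50)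
  where "y' \<sim>\<^sub>D y \<longleftrightarrow>
    (\<exists>a b c d. a \<noteq> 0 \<and> b \<noteq> 0 \<and> c \<noteq> 0 \<and> d \<noteq> 0 \<and> y' = rescale a b c d y)"


section \<open>Existence and uniqueness of the action\<close>

definition eval_mon :: "ratfun tuple \<Rightarrow> (var \<Rightarrow>\<^sub>0 nat) \<Rightarrow> ratfun"
  where "eval_mon y m = (\<Prod>v\<in>UNIV. y v ^ Poly_Mapping.lookup m v)"

definition eval_poly :: "ratfun tuple \<Rightarrow> polyn \<Rightarrow> ratfun"
  where "eval_poly y p =
    (\<Sum>m\<in>Poly_Mapping.keys p. const (Poly_Mapping.lookup p m) * eval_mon y m)"

lemma const_add: "const (a + b) = const a + const b"
  by (simp add: const_def single_add)

lemma const_mult: "const (a * b) = const a * const b"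
  by (simp add: const_def mult_single)

lemma const_0 [simp]: "const 0 = 0"
  by (simp add: const_def Zero_fract_def)

lemma const_1 [simp]: "const 1 = 1"
  by (simp add: const_def One_fract_def)

lemma eval_mon_add: "eval_mon y (m + n) = eval_mon y m * eval_mon y n"
  by (simp add: eval_mon_def lookup_add power_add prod.distrib)

lemma eval_mon_0 [simp]: "eval_mon y 0 = 1"
  by (simp add: eval_mon_def)

lemma eval_poly_superset:
  assumes "finite S" "Poly_Mapping.keys p \<subseteq> S"
  shows "eval_poly y p = (\<Sum>m\<in>S. const (Poly_Mapping.lookup p m) * eval_mon y m)"
  unfolding eval_poly_def
  by (rule sum.mono_neutral_left) (use assms in \<open>auto simp: in_keys_iff\<close>)

lemma eval_poly_add: "eval_poly y (p + q) = eval_poly y p + eval_poly y q"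
proof -
  let ?S = "Poly_Mapping.keys p \<union> Poly_Mapping.keys q"
  have fin: "finite ?S" by simp
  show ?thesis
    using eval_poly_superset[OF fin, of p y] eval_poly_superset[OF fin, of q y]
      eval_poly_superset[OF fin keys_add, of y]
    by (simp add: lookup_add const_add distrib_right sum.distrib)
qed

lemma eval_poly_0 [simp]: "eval_poly y 0 = 0"
  by (simp add: eval_poly_def)

lemma eval_poly_single: "eval_poly y (Poly_Mapping.single m c) = const c * eval_mon y m"
  by (simp add: eval_poly_def)

lemma eval_poly_1 [simp]: "eval_poly y 1 = 1"
  using eval_poly_single[of y 0 1] by simp

lemma polyn_induct [case_names zero add]:
  assumes zero: "P (0 :: polyn)"
    and add: "\<And>m c p. P p \<Longrightarrow> P (Poly_Mapping.single m c + p)"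
  shows "P p"
proof (induction p rule: update_induct)
  case const
  then show ?case using zero by simp
next
  case (update p a b)
  have "Poly_Mapping.update a b p = Poly_Mapping.single a b + p"
    using update(1)
    by (intro poly_mapping_eqI) (auto simp: lookup_update lookup_add lookup_single in_keys_iff when_def)
  then show ?case using add update by simp
qed

lemma eval_poly_single_mult:
  "eval_poly y (Poly_Mapping.single m c * q) = eval_poly y (Poly_Mapping.single m c) * eval_poly y q"
  by (induction q rule: polyn_induct)
    (simp_all add: distrib_left eval_poly_add mult_single eval_poly_single eval_mon_add const_mult)

lemma eval_poly_mult: "eval_poly y (p * q) = eval_poly y p * eval_poly y q"
  by (induction p rule: polyn_induct)
    (simp_all add: distrib_right eval_poly_add eval_poly_single_mult)

lemma X_power: "X v ^ n = Fract (Poly_Mapping.single (Poly_Mapping.single v n) 1) 1"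
  by (induction n) (simp_all add: One_fract_def X_def mult_single flip: single_add)

lemma eval_mon_X: "eval_mon X m = Fract (Poly_Mapping.single m 1) 1"
proof -
  have "(\<Prod>v\<in>A. X v ^ Poly_Mapping.lookup m v) =
      Fract (Poly_Mapping.single (\<Sum>v\<in>A. Poly_Mapping.single v (Poly_Mapping.lookup m v)) 1) 1"
    if "finite A" for A :: "var set"
    using that by induction (simp_all add: One_fract_def X_power mult_single)
  moreover have "(\<Sum>v\<in>UNIV. Poly_Mapping.single v (Poly_Mapping.lookup m v)) = m"
    by (intro poly_mapping_eqI) (simp add: lookup_sum lookup_single when_def)
  ultimately show ?thesis
    by (simp add: eval_mon_def)
qed

lemma eval_poly_X: "eval_poly X p = Fract p 1"
  by (induction p rule: polyn_induct)
    (simp_all add: Zero_fract_def eval_poly_add eval_poly_single const_def eval_mon_X mult_single)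

lemma automorphism_eval:
  assumes "algebra_automorphism \<phi>"
  shows "\<phi> (eval_poly y p) = eval_poly (\<lambda>v. \<phi> (y v)) p"
proof -
  have add: "\<phi> (r + s) = \<phi> r + \<phi> s" and mult: "\<phi> (r * s) = \<phi> r * \<phi> s"
    and const: "\<phi> (const c) = const c" for r s c
    using assms by (auto simp: algebra_automorphism_def)
  have zero: "\<phi> 0 = 0" using const[of 0] by simp
  have one: "\<phi> 1 = 1" using const[of 1] by simp
  have power: "\<phi> (r ^ n) = \<phi> r ^ n" for r n
    by (induction n) (simp_all add: one mult)
  have "\<phi> (\<Prod>v\<in>A. r v) = (\<Prod>v\<in>A. \<phi> (r v))" if "finite A" for A :: "var set" and r
    using that by induction (simp_all add: one mult)
  then have mon: "\<phi> (eval_mon y m) = eval_mon (\<lambda>v. \<phi> (y v)) m" for m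
    by (simp add: eval_mon_def power)
  show ?thesis
    by (induction p rule: polyn_induct)
      (simp_all add: zero eval_poly_add add eval_poly_single mult const mon)
qed

lemma automorphism_unique:
  assumes \<phi>: "algebra_automorphism \<phi>" and \<psi>: "algebra_automorphism \<psi>"
    and gens: "\<And>v. \<phi> (X v) = \<psi> (X v)"
  shows "\<phi> = \<psi>"
proof
  fix r :: ratfun
  obtain p q where r: "r = Fract p q" and q: "q \<noteq> 0"
    by (cases r) auto
  have poly: "\<phi> (Fract s 1) = \<psi> (Fract s 1)" for s
    using automorphism_eval[OF \<phi>, of X s] automorphism_eval[OF \<psi>, of X s] gens
    by (simp add: eval_poly_X)
  have eq: "r * Fract q 1 = Fract p 1"
    using q by (simp add: r eq_fract)
  have "\<phi> r * \<phi> (Fract q 1) = \<psi> r * \<phi> (Fract q 1)"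
    using \<phi> \<psi> poly eq unfolding algebra_automorphism_def by metis
  moreover have "\<phi> (Fract q 1) \<noteq> 0"
  proof
    assume "\<phi> (Fract q 1) = 0"
    moreover have "\<phi> 0 = 0"
      using \<phi> const_0 unfolding algebra_automorphism_def by metis
    moreover have "inj \<phi>"
      using \<phi> by (auto simp: algebra_automorphism_def bij_def)
    ultimately have "Fract q 1 = 0"
      by (metis injD)
    then show False using q by (simp add: Zero_fract_def eq_fract)
  qed
  ultimately show "\<phi> r = \<psi> r" by simp
qed

text \<open>
  \<open>subst_rel y r s\<close>: substituting the tuple \<open>y\<close> for the variables in \<open>r\<close> is defined, that is, \<open>r\<close>
  has a representation whose denominator does not vanish at \<open>y\<close>, and gives \<open>s\<close>.
\<close>

definition subst_rel :: "ratfun tuple \<Rightarrow> ratfun \<Rightarrow> ratfun \<Rightarrow> bool"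
  where "subst_rel y r s \<longleftrightarrow>
    (\<exists>p q. eval_poly y q \<noteq> 0 \<and> r = Fract p q \<and> s = eval_poly y p / eval_poly y q)"

lemma eval_poly_nonzeroD: "eval_poly y q \<noteq> 0 \<Longrightarrow> q \<noteq> 0"
  by auto

lemma subst_rel_functional:
  assumes "subst_rel y r s" "subst_rel y r t"
  shows "s = t"
proof -
  obtain p q where 1: "eval_poly y q \<noteq> 0" "r = Fract p q" "s = eval_poly y p / eval_poly y q"
    using assms(1) by (auto simp: subst_rel_def)
  obtain p' q' where 2: "eval_poly y q' \<noteq> 0" "r = Fract p' q'" "t = eval_poly y p' / eval_poly y q'"
    using assms(2) by (auto simp: subst_rel_def)
  have "p * q' = p' * q"
    using 1 2 eval_poly_nonzeroD by (metis eq_fract(1))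
  then have "eval_poly y p * eval_poly y q' = eval_poly y p' * eval_poly y q"
    by (metis eval_poly_mult)
  then show ?thesis
    using 1 2 by (simp add: frac_eq_eq)
qed

lemma subst_rel_poly: "subst_rel y (Fract p 1) (eval_poly y p)"
  unfolding subst_rel_def by (intro exI[of _ p] exI[of _ 1]) simp

lemma subst_rel_const: "subst_rel y (const c) (const c)"
  using subst_rel_poly[of y "Poly_Mapping.single 0 c"]
  by (simp add: const_def[symmetric] eval_poly_single)

lemma subst_rel_0: "subst_rel y 0 0"
  using subst_rel_const[of y 0] by simp

lemma subst_rel_1: "subst_rel y 1 1"
  using subst_rel_const[of y 1] by simp

lemma eval_mon_single: "eval_mon y (Poly_Mapping.single v n) = y v ^ n"
proof -
  have "eval_mon y (Poly_Mapping.single v n) = (\<Prod>u\<in>UNIV. if u = v then y v ^ n else 1)"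
    unfolding eval_mon_def by (intro prod.cong) (auto simp: lookup_single when_def)
  then show ?thesis by simp
qed

lemma subst_rel_X: "subst_rel y (X v) (y v)"
  using subst_rel_poly[of y "Poly_Mapping.single (Poly_Mapping.single v 1) 1"]
  by (simp add: X_def eval_poly_single eval_mon_single)

lemma subst_rel_add:
  assumes "subst_rel y r s" "subst_rel y r' s'"
  shows "subst_rel y (r + r') (s + s')"
proof -
  obtain p q where 1: "eval_poly y q \<noteq> 0" "r = Fract p q" "s = eval_poly y p / eval_poly y q"
    using assms(1) by (auto simp: subst_rel_def)
  obtain p' q' where 2: "eval_poly y q' \<noteq> 0" "r' = Fract p' q'" "s' = eval_poly y p' / eval_poly y q'"
    using assms(2) by (auto simp: subst_rel_def)
  have "r + r' = Fract (p * q' + p' * q) (q * q')"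
    using 1 2 eval_poly_nonzeroD by simp
  moreover have "s + s' = eval_poly y (p * q' + p' * q) / eval_poly y (q * q')"
    using 1 2 by (simp add: eval_poly_mult eval_poly_add add_frac_eq)
  moreover have "eval_poly y (q * q') \<noteq> 0"
    using 1 2 by (simp add: eval_poly_mult)
  ultimately show ?thesis
    unfolding subst_rel_def by blast
qed

lemma subst_rel_mult:
  assumes "subst_rel y r s" "subst_rel y r' s'"
  shows "subst_rel y (r * r') (s * s')"
proof -
  obtain p q where 1: "eval_poly y q \<noteq> 0" "r = Fract p q" "s = eval_poly y p / eval_poly y q"
    using assms(1) by (auto simp: subst_rel_def)
  obtain p' q' where 2: "eval_poly y q' \<noteq> 0" "r' = Fract p' q'" "s' = eval_poly y p' / eval_poly y q'"
    using assms(2) by (auto simp: subst_rel_def)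
  show ?thesis
    unfolding subst_rel_def
    by (intro exI[of _ "p * p'"] exI[of _ "q * q'"]) (use 1 2 in \<open>auto simp: eval_poly_mult\<close>)
qed

lemma subst_rel_minus:
  assumes "subst_rel y r s" "subst_rel y r' s'"
  shows "subst_rel y (r - r') (s - s')"
proof -
  have "const (-1) = - 1"
    using const_add[of 1 "-1"] by (simp add: eq_neg_iff_add_eq_0 add.commute)
  then have "subst_rel y (- 1 * r') (- 1 * s')"
    using subst_rel_mult[OF subst_rel_const[of y "-1"] assms(2)] by simp
  from subst_rel_add[OF assms(1) this] show ?thesis by simp
qed

lemma subst_rel_divide:
  assumes "subst_rel y r s" "subst_rel y r' s'" "s' \<noteq> 0"
  shows "subst_rel y (r / r') (s / s')"
proof -
  obtain p q where 1: "eval_poly y q \<noteq> 0" "r = Fract p q" "s = eval_poly y p / eval_poly y q"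
    using assms(1) by (auto simp: subst_rel_def)
  obtain p' q' where 2: "eval_poly y q' \<noteq> 0" "r' = Fract p' q'" "s' = eval_poly y p' / eval_poly y q'"
    using assms(2) by (auto simp: subst_rel_def)
  show ?thesis
    unfolding subst_rel_def
    by (intro exI[of _ "p * q'"] exI[of _ "q * p'"])
      (use 1 2 assms(3) in \<open>auto simp: eval_poly_mult\<close>)
qed

lemma subst_rel_eval_poly:
  assumes "\<And>v. subst_rel y (z v) (z' v)"
  shows "subst_rel y (eval_poly z p) (eval_poly z' p)"
proof -
  have power: "subst_rel y (r ^ n) (s ^ n)" if "subst_rel y r s" for r s n
    by (induction n) (auto intro: subst_rel_1 subst_rel_mult that)
  have "subst_rel y (\<Prod>v\<in>A. z v ^ e v) (\<Prod>v\<in>A. z' v ^ e v)"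
    if "finite A" for A and e :: "var \<Rightarrow> nat"
    using that by induction (auto intro: subst_rel_1 subst_rel_mult power assms)
  then have "subst_rel y (eval_mon z m) (eval_mon z' m)" for m
    by (simp add: eval_mon_def)
  then show ?thesis
    by (induction p rule: polyn_induct)
      (auto simp: eval_poly_add eval_poly_single
        intro: subst_rel_0 subst_rel_add subst_rel_mult subst_rel_const)
qed

lemma involution_automorphism:
  assumes inv: "\<And>v. subst_rel y (y v) (X v)"
  obtains \<phi> where "algebra_automorphism \<phi>" "\<And>v. \<phi> (X v) = y v"
proof -
  have returns: "subst_rel y (eval_poly y p) (eval_poly X p)" for p
    using inv by (rule subst_rel_eval_poly)
  have inj: "eval_poly y q \<noteq> 0" if "q \<noteq> 0" for q
  proof
    assume "eval_poly y q = 0"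
    then have "subst_rel y 0 (eval_poly X q)"
      using returns[of q] by simp
    then have "eval_poly X q = 0"
      using subst_rel_functional subst_rel_0 by blast
    then show False
      using that by (simp add: eval_poly_X Zero_fract_def eq_fract)
  qed
  have total: "\<exists>s. subst_rel y r s" for r
  proof -
    obtain p q where "r = Fract p q" "q \<noteq> 0"
      by (cases r) auto
    then show ?thesis
      using inj unfolding subst_rel_def by blast
  qed
  define \<phi> where "\<phi> r = (SOME s. subst_rel y r s)" for r
  have \<phi>: "subst_rel y r (\<phi> r)" for r
    unfolding \<phi>_def using total by (rule someI_ex)
  have \<phi>_eq: "\<phi> r = s" if "subst_rel y r s" for r s
    using \<phi> that subst_rel_functional by blast
  have \<phi>\<phi>: "\<phi> (\<phi> r) = r" for r
  proof -
    obtain p q where r: "r = Fract p q" and q: "q \<noteq> 0"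
      by (cases r) auto
    have "\<phi> r = eval_poly y p / eval_poly y q"
      unfolding r by (rule \<phi>_eq) (use inj[OF q] in \<open>unfold subst_rel_def, blast\<close>)
    moreover have "subst_rel y (eval_poly y p / eval_poly y q) (Fract p 1 / Fract q 1)"
      using returns[of p] returns[of q] q
      by (intro subst_rel_divide) (auto simp: eval_poly_X Zero_fract_def eq_fract)
    ultimately show ?thesis
      using \<phi>_eq by (simp add: r)
  qed
  have "algebra_automorphism \<phi>"
    unfolding algebra_automorphism_def
    by (intro conjI allI involuntory_imp_bij \<phi>\<phi> \<phi>_eq subst_rel_add subst_rel_mult subst_rel_const \<phi>)
  moreover have "\<phi> (X v) = y v" for v
    by (intro \<phi>_eq subst_rel_X)
  ultimately show thesis using that by blast
qed

lemma X_nonzero [simp]: "X v \<noteq> 0"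
proof
  assume "X v = 0"
  then have "Poly_Mapping.lookup (Poly_Mapping.single (Poly_Mapping.single v 1) (1 :: complex))
      (Poly_Mapping.single v (1 :: nat)) = 0"
    by (simp add: X_def Zero_fract_def eq_fract)
  then show False by simp
qed

lemma eval_mon_X_inject: "eval_mon X m = eval_mon X n \<longleftrightarrow> m = n"
proof
  assume "eval_mon X m = eval_mon X n"
  then have "Poly_Mapping.single m (1 :: complex) = Poly_Mapping.single n 1"
    by (simp add: eval_mon_X eq_fract)
  then have "Poly_Mapping.keys (Poly_Mapping.single m (1 :: complex)) =
      Poly_Mapping.keys (Poly_Mapping.single n (1 :: complex))"
    by simp
  then show "m = n" by simp
qed simp

lemma monomials_distinct:
  "X F \<noteq> X Nu3" "X F * X Nu7 \<noteq> X Kappa1" "X G * X Nu1 \<noteq> 1" "X G * X Kappa2 \<noteq> X Nu5"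
proof -
  let ?s = "\<lambda>v. Poly_Mapping.single v (1 :: nat)"
  have X: "X v = eval_mon X (?s v)" for v
    by (simp add: eval_mon_single)
  have ne: "m \<noteq> n" if "Poly_Mapping.lookup m v \<noteq> Poly_Mapping.lookup n v"
    for m n :: "var \<Rightarrow>\<^sub>0 nat" and v
    using that by auto
  have "eval_mon X (?s F) \<noteq> eval_mon X (?s Nu3)"
    unfolding eval_mon_X_inject by (rule ne[of _ F]) (simp add: lookup_single)
  then show "X F \<noteq> X Nu3" by (simp add: eval_mon_single)
  have "eval_mon X (?s F + ?s Nu7) \<noteq> eval_mon X (?s Kappa1)"
    unfolding eval_mon_X_inject by (rule ne[of _ F]) (simp add: lookup_add lookup_single)
  then show "X F * X Nu7 \<noteq> X Kappa1" by (simp add: eval_mon_single eval_mon_add)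
  have "eval_mon X (?s G + ?s Nu1) \<noteq> eval_mon X 0"
    unfolding eval_mon_X_inject by (rule ne[of _ G]) (simp add: lookup_add lookup_single)
  then show "X G * X Nu1 \<noteq> 1" by (simp add: eval_mon_single eval_mon_add)
  have "eval_mon X (?s G + ?s Kappa2) \<noteq> eval_mon X (?s Nu5)"
    unfolding eval_mon_X_inject by (rule ne[of _ G]) (simp add: lookup_add lookup_single)
  then show "X G * X Kappa2 \<noteq> X Nu5" by (simp add: eval_mon_single eval_mon_add)
qed

lemma denominators_nonzero:
  "X F - X Nu3 \<noteq> 0" "X F - X Kappa1 / X Nu7 \<noteq> 0"
  "X G - 1 / X Nu1 \<noteq> 0" "X G - X Nu5 / X Kappa2 \<noteq> 0"
  using monomials_distinct by (auto simp: eq_divide_eq)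

lemma R_involutive: "R w (R w X) v = X v"
  using denominators_nonzero by (cases w; cases v) simp_all

lemma subst_rel_R:
  assumes "\<And>v. y v \<noteq> 0"
    and "w = S2 \<Longrightarrow> y F - y Kappa1 / y Nu7 \<noteq> 0"
    and "w = S3 \<Longrightarrow> y G - y Nu5 / y Kappa2 \<noteq> 0"
  shows "subst_rel y (R w X v) (R w y v)"
  using assms
  by (cases w; cases v)
    (auto intro!: subst_rel_divide subst_rel_mult subst_rel_minus subst_rel_1 subst_rel_X
      simp del: times_divide_eq_right times_divide_eq_left)

lemma R_X_nonzero: "R w X v \<noteq> 0"
  using denominators_nonzero by (cases w; cases v) simp_all

lemma action_ex1: "\<exists>!\<phi>. algebra_automorphism \<phi> \<and> (\<forall>v. \<phi> (X v) = R w X v)"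
proof -
  have "subst_rel (R w X) (R w X v) (X v)" for v
  proof -
    have "subst_rel (R w X) (R w X v) (R w (R w X) v)"
      using denominators_nonzero by (intro subst_rel_R R_X_nonzero) simp_all
    then show ?thesis by (simp only: R_involutive)
  qed
  then obtain \<phi> where "algebra_automorphism \<phi>" "\<And>v. \<phi> (X v) = R w X v"
    using involution_automorphism by blast
  then show ?thesis
    by (intro ex1I[of _ \<phi>]) (auto intro: automorphism_unique)
qed

lemma action_automorphism: "algebra_automorphism (action w)"
  and action_X: "action w (X v) = R w X v"
  using theI'[OF action_ex1[of w]] unfolding action_def by auto

end

theory Submission
  imports Defs
begin

text \<open>
  Every generator carries rescaled tuples to rescaled tuples: it leaves the scaling factors
  $(a,b,c,d)$ unchanged, or turns them into $(1/a,1/d,1/c,1/b)$ for $\pi_1$ and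
  $(1/d,1/c,1/b,1/a)$ for $\pi_2$. Since the action is by field automorphisms, both sides of the
  claim are therefore rescalings of $w(x)$.
\<close>

lemma rescale_rescale:
  "rescale a b c d (rescale a' b' c' d' y) = rescale (a * a') (b * b') (c * c') (d * d') y"
  by (simp add: rescale_def fun_eq_iff mult_ac)

text \<open>Factors multiply under composition, so two rescalings of one tuple differ by the
  quotients of their factors.\<close>

lemma equivD5_rescale_rescale:
  assumes "a \<noteq> 0" "b \<noteq> 0" "c \<noteq> 0" "d \<noteq> 0" "a' \<noteq> 0" "b' \<noteq> 0" "c' \<noteq> 0" "d' \<noteq> 0"
  shows "rescale a b c d y \<sim>\<^sub>D rescale a' b' c' d' y"
  unfolding equivD5_def
  by (intro exI[of _ "a / a'"] exI[of _ "b / b'"] exI[of _ "c / c'"] exI[of _ "d / d'"])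
    (simp add: assms rescale_rescale)

lemma R_rescale:
  fixes y :: "'a::field tuple"
  assumes nz: "a \<noteq> 0" "b \<noteq> 0" "c \<noteq> 0" "d \<noteq> 0"
  obtains a' b' c' d' where "a' \<noteq> 0" "b' \<noteq> 0" "c' \<noteq> 0" "d' \<noteq> 0"
    "R w (rescale a b c d y) = rescale a' b' c' d' (R w y)"
proof (cases "w = Pi1 \<or> w = Pi2")
  case False
  \<comment> \<open>The fractions multiplying g under \<open>S2\<close> and f under
    \<open>S3\<close> are invariant: all their terms scale by b, respectively 1/a.\<close>
  have F: "(b * s - b * t) / (b * s - b * u) = (s - t) / (s - u)" for s t u
    using nz by (simp flip: right_diff_distrib)
  have G: "(s / a - 1 / (a * t)) / (s / a - u / (a * r)) = (s - 1 / t) / (s - u / r)" for r s t u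
  proof -
    have "s / a - 1 / (a * t) = (s - 1 / t) / a" "s / a - u / (a * r) = (s - u / r) / a"
      by (simp_all add: diff_divide_distrib mult.commute)
    then show ?thesis
      using nz by simp
  qed
  \<comment> \<open>For instance, \<kappa>1/\<nu>7 scales by bd/d = b, the factor of the slot of
    \<nu>3 that it fills under \<open>S2\<close>.\<close>
  have cancel: "b * d * s / (d * t) = b * (s / t)" "b * d * s / (b * t) = d * (s / t)"
    "a * c * s / (c * t) = a * (s / t)" "a * c * s / (a * t) = c * (s / t)"
    "c * s / (a * c * t) = s / (a * t)" for s t
    using nz by simp_all
  have "R w (rescale a b c d y) v = rescale a b c d (R w y) v" for v
    using False nz
    by (cases w; cases v)
      (simp_all add: rescale_def F G cancel del: times_divide_eq_right times_divide_eq_left,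
       simp_all add: mult_ac)
  then show thesis
    using that nz by blast
next
  case True
  then show thesis
  proof
    assume w: "w = Pi1"
    \<comment> \<open>The slot of \<nu>3 receives 1/\<nu>7, hence 1/d replaces b; f/\<kappa>1
      agrees, scaling by b/(bd) = 1/d.\<close>
    have "R w (rescale a b c d y) = rescale (1 / a) (1 / d) (1 / c) (1 / b) (R w y)"
      using nz by (simp add: w rescale_def fun_eq_iff mult_ac)
    then show thesis
      using that[of "1 / a" "1 / d" "1 / c" "1 / b"] nz by simp
  next
    assume w: "w = Pi2"
    have "R w (rescale a b c d y) = rescale (1 / d) (1 / c) (1 / b) (1 / a) (R w y)"
      using nz by (simp add: w rescale_def fun_eq_iff mult_ac)
    then show thesis
      using that[of "1 / d" "1 / c" "1 / b" "1 / a"] nz by simp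
  qed
qed

context
  fixes \<phi> :: "ratfun \<Rightarrow> ratfun"
  assumes \<phi>: "algebra_automorphism \<phi>"
begin

lemma automorphism_mult: "\<phi> (r * s) = \<phi> r * \<phi> s"
  using \<phi> by (simp add: algebra_automorphism_def)

text \<open>Injectivity keeps the images of the scaling factors nonzero.\<close>

lemma automorphism_eq_0_iff: "\<phi> r = 0 \<longleftrightarrow> r = 0"
proof -
  have "\<phi> 0 = 0" "inj \<phi>"
    using \<phi> const_0 unfolding algebra_automorphism_def bij_def by metis+
  then show ?thesis
    by (metis injD)
qed

lemma automorphism_divide: "\<phi> (r / s) = \<phi> r / \<phi> s"
proof (cases "s = 0")
  case True
  then show ?thesis
    using automorphism_eq_0_iff[of 0] by simp
next
  case False
  then show ?thesis
    using automorphism_mult[of "r / s" s] by (simp add: automorphism_eq_0_iff eq_divide_eq)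
qed

text \<open>The factors are elements of K, not just constants, so \<phi> moves them too; rescaling
  involves only products and quotients, which \<phi> preserves.\<close>

lemma automorphism_rescale:
  "(\<lambda>v. \<phi> (rescale a b c d y v)) = rescale (\<phi> a) (\<phi> b) (\<phi> c) (\<phi> d) (\<lambda>v. \<phi> (y v))"
  by (simp add: rescale_def fun_eq_iff automorphism_mult automorphism_divide)

end

theorem theorem3p5:
  fixes x' :: "ratfun tuple" and w :: generator
  assumes "x' \<sim>\<^sub>D X"
  shows "(\<lambda>v. action w (x' v)) \<sim>\<^sub>D R w x'"
proof -
  obtain a b c d where nz: "a \<noteq> 0" "b \<noteq> 0" "c \<noteq> 0" "d \<noteq> 0" and x': "x' = rescale a b c d X"
    using assms by (auto simp: equivD5_def)
  obtain a' b' c' d' where nz': "a' \<noteq> 0" "b' \<noteq> 0" "c' \<noteq> 0" "d' \<noteq> 0"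
    and R: "R w x' = rescale a' b' c' d' (R w X)"
    using R_rescale[OF nz] x' by metis
  let ?w = "action w"
  \<comment> \<open>This rescales the same tuple \<open>R w X\<close> as in \<open>R\<close>, with
    the factors moved by w instead of a', b', c', d'.\<close>
  have "(\<lambda>v. ?w (x' v)) = rescale (?w a) (?w b) (?w c) (?w d) (R w X)"
    using automorphism_rescale[OF action_automorphism] by (simp add: x' action_X)
  then show ?thesis
    using nz nz' automorphism_eq_0_iff[OF action_automorphism]
    by (simp add: R equivD5_rescale_rescale)
qed

end
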